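(* Let $u_1,\ldots,u_d\in B_p$ be linearly independent in $L^2(p\cdot\mu)$, and define $V(x)=(u_1(x),\ldots,u_d(x),1)^\top\in\mathbb{R}^{d+1}$. The map $\mathcal{F}:\mathcal{N}\to\mathrm{SPD}(d+1)$ defined by $$\mathcal{F}(p_\theta):=\mathbb{E}_{p_\theta}\left[V(x)V(x)^\top\right]=:S(\theta)$$ is well-defined, and $S(\theta)\in\mathrm{SPD}(d+1)$ for every $\theta\in\Theta$. The matrix $S(\theta)$ has the block structure $$S(\theta)=\begin{pmatrix}A(\theta)&\eta(\theta)\\ \eta(\theta)^\top&1\end{pmatrix},$$ where $[A(\theta)]_{jk}:=\mathbb{E}_{p_\theta}[u_ju_k]$ for $j,k=1,\ldots,d$ and $[\eta(\theta)]_j:=\mathbb{E}_{p_\theta}[u_j]$ for $j=1,\ldots,d$.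
   Context: Let $(X,\mathcal{X},\mu)$ be a $\sigma$-finite measure space and let $\mathcal{M}_\mu$ be the set of measurable $p:X\to\mathbb{R}$ with $p>0$ $\mu$-a.e. and $\int_X p\,d\mu=1$. For $p\in\mathcal{M}_\mu$ write $\mathbb{E}_p[u]=\int_X u\,p\,d\mu$ (entrywise for matrices). Fix a reference density $p\in\mathcal{M}_\mu$. Let $B_p$ be the Banach space of ($\mu$-a.e. classes of) measurable $u:X\to\mathbb{R}$ such that $\mathbb{E}_p[\cosh(\alpha u)-1]<\infty$ for some $\alpha>0$ and $\mathbb{E}_p[u]=0$, with norm $\|u\|_p=\inf\{r>0:\mathbb{E}_p[\cosh(u/r)-1]\le 1\}$. For $u\in B_p$ let $K_p(u)=\log\mathbb{E}_p[e^u]\in[0,+\infty]$, $\mathrm{Dom}(K_p)=\{u\in B_p:K_p(u)<\infty\}$, with interior $\mathrm{Dom}(K_p)^\circ$ in $B_p$. For $u_1,\ldots,u_d\in B_p$ ($d\ge 1$), let $\Theta=\{\theta\in\mathbb{R}^d:\sum_j\theta_ju_j\in\mathrm{Dom}(K_p)^\circ\}$ (open), $\psi(\theta)=K_p(\sum_j\theta_ju_j)$, $p_\theta=e^{\sum_j\theta_ju_j-\psi(\theta)}p$, and $\mathcal{N}=\{p_\theta:\theta\in\Theta\}$. $\mathrm{SPD}(m)$ denotes the set of real symmetric positive definite $m\times m$ matrices. *)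

theory Defs
  imports "HOL-Analysis.Analysis"
begin

text \<open>
  Throughout, \<open>M\<close> is the measure space \<open>(X, \<X>, \<mu>)\<close>. Densities and random variables are
  represented by measurable functions, not by their classes modulo equality \<open>\<mu>\<close>-almost everywhere.
  All notions below are invariant under changing a function on a null set.
\<close>

definition densities :: "'x measure \<Rightarrow> ('x \<Rightarrow> real) set" where
  "densities M = {p \<in> borel_measurable M.
     (AE x in M. p x > 0) \<and> integrable M p \<and> (\<integral>x. p x \<partial>M) = 1}"

definition expect :: "'x measure \<Rightarrow> ('x \<Rightarrow> real) \<Rightarrow> ('x \<Rightarrow> real) \<Rightarrow> real" where
  "expect M p f = (\<integral>x. f x * p x \<partial>M)"

text \<open>The expectation of a nonnegative \<open>f\<close>, with value \<open>\<infinity>\<close> allowed.\<close>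

definition nn_expect :: "'x measure \<Rightarrow> ('x \<Rightarrow> real) \<Rightarrow> ('x \<Rightarrow> real) \<Rightarrow> ennreal" where
  "nn_expect M p f = (\<integral>\<^sup>+x. ennreal (f x * p x) \<partial>M)"

definition B_space :: "'x measure \<Rightarrow> ('x \<Rightarrow> real) \<Rightarrow> ('x \<Rightarrow> real) set" where
  "B_space M p = {u \<in> borel_measurable M.
     (\<exists>\<alpha>>0. nn_expect M p (\<lambda>x. cosh (\<alpha> * u x) - 1) < \<infinity>) \<and> expect M p u = 0}"

definition B_norm :: "'x measure \<Rightarrow> ('x \<Rightarrow> real) \<Rightarrow> ('x \<Rightarrow> real) \<Rightarrow> real" where
  "B_norm M p u = Inf {r. r > 0 \<and> nn_expect M p (\<lambda>x. cosh (u x / r) - 1) \<le> 1}"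

definition cumulant :: "'x measure \<Rightarrow> ('x \<Rightarrow> real) \<Rightarrow> ('x \<Rightarrow> real) \<Rightarrow> ereal" where
  "cumulant M p u =
     (let E = nn_expect M p (\<lambda>x. exp (u x))
      in if E = \<infinity> then \<infinity> else ereal (ln (enn2real E)))"

definition cumulant_dom :: "'x measure \<Rightarrow> ('x \<Rightarrow> real) \<Rightarrow> ('x \<Rightarrow> real) set" where
  "cumulant_dom M p = {u \<in> B_space M p. cumulant M p u < \<infinity>}"

text \<open>
  Interior with respect to \<open>B_norm\<close>. On representatives \<open>B_norm\<close> is only a seminorm, vanishing
  exactly on the functions that are zero almost everywhere, so this is the set of representatives
  of the interior in the Banach space of classes.
\<close>

definition B_interior ::
    "'x measure \<Rightarrow> ('x \<Rightarrow> real) \<Rightarrow> ('x \<Rightarrow> real) set \<Rightarrow> ('x \<Rightarrow> real) set" where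
  "B_interior M p D = {u \<in> B_space M p.
     \<exists>\<epsilon>>0. \<forall>v \<in> B_space M p. B_norm M p (\<lambda>x. v x - u x) < \<epsilon> \<longrightarrow> v \<in> D}"

definition lin_comb :: "('d::finite \<Rightarrow> 'x \<Rightarrow> real) \<Rightarrow> real ^ 'd \<Rightarrow> 'x \<Rightarrow> real" where
  "lin_comb u \<theta> x = (\<Sum>j\<in>UNIV. \<theta> $ j * u j x)"

definition Theta ::
    "'x measure \<Rightarrow> ('x \<Rightarrow> real) \<Rightarrow> ('d::finite \<Rightarrow> 'x \<Rightarrow> real) \<Rightarrow> (real ^ 'd) set" where
  "Theta M p u = {\<theta>. lin_comb u \<theta> \<in> B_interior M p (cumulant_dom M p)}"

definition psi ::
    "'x measure \<Rightarrow> ('x \<Rightarrow> real) \<Rightarrow> ('d::finite \<Rightarrow> 'x \<Rightarrow> real) \<Rightarrow> real ^ 'd \<Rightarrow> real" where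
  "psi M p u \<theta> = real_of_ereal (cumulant M p (lin_comb u \<theta>))"

definition exp_density ::
    "'x measure \<Rightarrow> ('x \<Rightarrow> real) \<Rightarrow> ('d::finite \<Rightarrow> 'x \<Rightarrow> real) \<Rightarrow> real ^ 'd \<Rightarrow> 'x \<Rightarrow> real" where
  "exp_density M p u \<theta> x = exp (lin_comb u \<theta> x - psi M p u \<theta>) * p x"

definition exp_family ::
    "'x measure \<Rightarrow> ('x \<Rightarrow> real) \<Rightarrow> ('d::finite \<Rightarrow> 'x \<Rightarrow> real) \<Rightarrow> ('x \<Rightarrow> real) set" where
  "exp_family M p u = exp_density M p u ` Theta M p u"

text \<open>Equality in \<open>L\<^sup>2(p\<cdot>\<mu>)\<close> is equality almost everywhere with respect to \<open>p\<cdot>\<mu>\<close>.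
  Elements of \<open>B_space M p\<close> are square integrable for \<open>p\<cdot>\<mu>\<close> since \<open>cosh t - 1 \<ge> t\<^sup>2 / 2\<close>.\<close>

definition lin_indep_L2 ::
    "'x measure \<Rightarrow> ('x \<Rightarrow> real) \<Rightarrow> ('d::finite \<Rightarrow> 'x \<Rightarrow> real) \<Rightarrow> bool" where
  "lin_indep_L2 M p u \<longleftrightarrow>
     (\<forall>c. (AE x in density M (\<lambda>x. ennreal (p x)). lin_comb u c x = 0) \<longrightarrow> c = 0)"

definition SPD :: "(real ^ 'm ^ 'm) set" where
  "SPD = {A. transpose A = A \<and> (\<forall>x. x \<noteq> 0 \<longrightarrow> x \<bullet> (A *v x) > 0)}"

text \<open>The index type \<open>'d + unit\<close> has \<open>d + 1\<close> elements: \<open>Inl j\<close> is the position of \<open>u\<^sub>j\<close>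
  and \<open>Inr ()\<close> is the last position.\<close>

definition V :: "('d::finite \<Rightarrow> 'x \<Rightarrow> real) \<Rightarrow> 'x \<Rightarrow> real ^ ('d + unit)" where
  "V u x = (\<chi> i. case i of Inl j \<Rightarrow> u j x | Inr _ \<Rightarrow> 1)"

definition F_map ::
    "'x measure \<Rightarrow> ('d::finite \<Rightarrow> 'x \<Rightarrow> real) \<Rightarrow> ('x \<Rightarrow> real) \<Rightarrow>
     real ^ ('d + unit) ^ ('d + unit)" where
  "F_map M u q = (\<chi> i k. expect M q (\<lambda>x. V u x $ i * V u x $ k))"

definition S ::
    "'x measure \<Rightarrow> ('x \<Rightarrow> real) \<Rightarrow> ('d::finite \<Rightarrow> 'x \<Rightarrow> real) \<Rightarrow> real ^ 'd \<Rightarrow>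
     real ^ ('d + unit) ^ ('d + unit)" where
  "S M p u \<theta> = F_map M u (exp_density M p u \<theta>)"

definition A_block ::
    "'x measure \<Rightarrow> ('x \<Rightarrow> real) \<Rightarrow> ('d::finite \<Rightarrow> 'x \<Rightarrow> real) \<Rightarrow> real ^ 'd \<Rightarrow> real ^ 'd ^ 'd" where
  "A_block M p u \<theta> = (\<chi> j k. expect M (exp_density M p u \<theta>) (\<lambda>x. u j x * u k x))"

definition eta ::
    "'x measure \<Rightarrow> ('x \<Rightarrow> real) \<Rightarrow> ('d::finite \<Rightarrow> 'x \<Rightarrow> real) \<Rightarrow> real ^ 'd \<Rightarrow> real ^ 'd" where
  "eta M p u \<theta> = (\<chi> j. expect M (exp_density M p u \<theta>) (u j))"

text \<open>The block matrix with rows \<open>(A, b)\<close> and \<open>(c\<^sup>T, e)\<close>.\<close>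

definition block_mat ::
    "real ^ 'd ^ 'd \<Rightarrow> real ^ 'd \<Rightarrow> real ^ 'd \<Rightarrow> real \<Rightarrow> real ^ ('d::finite + unit) ^ ('d + unit)" where
  "block_mat A b c e = (\<chi> i k. case i of
       Inl j \<Rightarrow> (case k of Inl l \<Rightarrow> A $ j $ l | Inr _ \<Rightarrow> b $ j)
     | Inr _ \<Rightarrow> (case k of Inl l \<Rightarrow> c $ l | Inr _ \<Rightarrow> e))"

text \<open>Well-definedness of \<open>F_map\<close> at \<open>p\<^sub>\<theta>\<close>: \<open>p\<^sub>\<theta>\<close> is a density, and for all
  representatives \<open>q\<close> of \<open>p\<^sub>\<theta>\<close> and \<open>v\<^sub>j\<close> of \<open>u\<^sub>j\<close> the entries of \<open>E\<^sub>q[V V\<^sup>T]\<close> are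
  convergent integrals whose values do not depend on the representatives (nor, as \<open>q\<close> may
  itself be a \<open>p\<^sub>\<theta>\<^sub>'\<close>, on the parameter).\<close>

definition F_well_defined_at ::
    "'x measure \<Rightarrow> ('x \<Rightarrow> real) \<Rightarrow> ('d::finite \<Rightarrow> 'x \<Rightarrow> real) \<Rightarrow> real ^ 'd \<Rightarrow> bool" where
  "F_well_defined_at M p u \<theta> \<longleftrightarrow>
     exp_density M p u \<theta> \<in> densities M \<and>
     (\<forall>q v. q \<in> borel_measurable M \<longrightarrow> (AE x in M. q x = exp_density M p u \<theta> x) \<longrightarrow>
        (\<forall>j. v j \<in> borel_measurable M \<and> (AE x in M. v j x = u j x)) \<longrightarrow>
        (\<forall>i k. integrable M (\<lambda>x. V v x $ i * V v x $ k * q x)) \<and>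
        F_map M v q = S M p u \<theta>)"

end

theory Submission
  imports Defs
begin

text \<open>
  Two facts are needed: the second moments of \<open>V\<close> under \<open>p\<^sub>\<theta>\<close> are finite, and the quadratic
  form of the matrix that they make up vanishes only at \<open>0\<close>.

  Finiteness is where the interior of the domain of the cumulant functional matters. Let \<open>w\<close> be an
  interior point and \<open>u \<in> B\<^sub>p\<close>. Small multiples of \<open>u\<close> have small norm
  (\<open>B_norm_small_multiples\<close>) and \<open>B\<^sub>p\<close> is a vector space (\<open>B_space_add\<close>,
  \<open>B_space_scale\<close>), so \<open>w + t u\<close> and \<open>w - t u\<close> are still in the domain for some \<open>t > 0\<close>. Hence
  \<open>exp (w + t u) + exp (w - t u) = 2 exp w cosh (t u)\<close> is integrable against \<open>p\<close>, and since
  \<open>cosh\<close> dominates a multiple of the square, so is \<open>u\<^sup>2 exp w\<close>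
  (\<open>interior_square_exp_integrable\<close>). Applied to \<open>w = \<Sum>\<^sub>j \<theta>\<^sub>j u\<^sub>j\<close>, this says that every \<open>u\<^sub>j\<close>
  is square integrable under \<open>p\<^sub>\<theta>\<close>; the mixed products follow from \<open>2 |a b| \<le> a\<^sup>2 + b\<^sup>2\<close>.

  For definiteness, \<open>z\<^sup>T S(\<theta>) z\<close> is the expectation of \<open>(z\<^sup>T V)\<^sup>2\<close> under \<open>p\<^sub>\<theta>\<close>
  (\<open>F_map_quadratic_form\<close>). If it is zero, then \<open>z\<^sup>T V = \<Sum>\<^sub>j c\<^sub>j u\<^sub>j + b\<close> vanishes almost everywhere,
  as \<open>p\<^sub>\<theta> > 0\<close> almost everywhere. The \<open>u\<^sub>j\<close> are centred for \<open>p\<close>, so taking the expectation under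
  \<open>p\<close> gives \<open>b = 0\<close>, and linear independence gives \<open>c = 0\<close> (\<open>lin_indep_with_constant\<close>).
\<close>

section \<open>Elementary inequalities for the hyperbolic cosine\<close>

lemma cosh_mono_abs: "\<bar>y\<bar> \<le> \<bar>z\<bar> \<Longrightarrow> cosh y \<le> cosh (z :: real)"
  using cosh_real_nonneg_le_iff[of "\<bar>y\<bar>" "\<bar>z\<bar>"] by simp

text \<open>
  Convexity of \<open>cosh\<close> between \<open>0\<close> and \<open>y\<close>. Shrinking the argument makes the excess over \<open>1\<close> as
  small as desired, uniformly in \<open>y\<close> relative to the original excess; this bounds the norm of
  small multiples without a limit theorem.
\<close>

lemma cosh_minus_1_scale:
  fixes y s :: real
  assumes "0 \<le> s" "s \<le> 1"
  shows "cosh (s * y) - 1 \<le> s * (cosh y - 1)"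
proof -
  have *: "exp (s * z) \<le> 1 - s + s * exp z" for z :: real
    using convex_onD[OF exp_convex, of s 0 z] assms by simp
  from *[of y] *[of "- y"] show ?thesis
    by (simp add: cosh_def field_simps)
qed

lemma abs_le_2_cosh: "\<bar>y\<bar> \<le> 2 * cosh (y :: real)"
proof -
  have "\<bar>y\<bar> \<le> exp \<bar>y\<bar>"
    using exp_ge_add_one_self[of "\<bar>y\<bar>"] by linarith
  also have "\<dots> \<le> 2 * cosh \<bar>y\<bar>"
    by (simp add: cosh_def)
  finally show ?thesis by simp
qed

lemma square_le_4_cosh: "y\<^sup>2 \<le> 4 * cosh (y :: real)"
proof -
  have "y\<^sup>2 \<le> 2 * exp \<bar>y\<bar>"
    using exp_lower_Taylor_quadratic[of "\<bar>y\<bar>"] by simp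
  also have "\<dots> \<le> 4 * cosh \<bar>y\<bar>"
    by (simp add: cosh_def)
  finally show ?thesis by simp
qed

section \<open>Expectations with respect to a density\<close>

lemma densitiesD:
  assumes "p \<in> densities M"
  shows "p \<in> borel_measurable M" "AE x in M. p x > 0" "integrable M p" "(\<integral>x. p x \<partial>M) = 1"
  using assms by (auto simp: densities_def)

text \<open>
  The definitions of \<open>B_space\<close> and of the cumulant functional use integrals with values in
  \<open>[0, \<infinity>]\<close>. This equivalence and the next lemma turn them into statements about Bochner integrals;
  nonnegativity of \<open>f\<close> and \<open>p\<close> makes the truncation of negative values in \<open>ennreal\<close> harmless.
\<close>

lemma nn_expect_finite_iff:
  assumes p: "p \<in> densities M" and f: "f \<in> borel_measurable M" "\<And>x. 0 \<le> f x"
  shows "nn_expect M p f < \<infinity> \<longleftrightarrow> integrable M (\<lambda>x. f x * p x)"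
proof -
  have "AE x in M. 0 \<le> f x * p x"
    using densitiesD(2)[OF p] by eventually_elim (simp add: f(2))
  then have "nn_expect M p f = (\<integral>\<^sup>+x. ennreal (norm (f x * p x)) \<partial>M)"
    unfolding nn_expect_def by (intro nn_integral_cong_AE) auto
  then show ?thesis
    using f(1) densitiesD(1)[OF p] by (simp add: integrable_iff_bounded)
qed

lemma nn_expect_eq_expect:
  assumes p: "p \<in> densities M" and f: "integrable M (\<lambda>x. f x * p x)" "\<And>x. 0 \<le> f x"
  shows "nn_expect M p f = ennreal (expect M p f)"
  unfolding nn_expect_def expect_def
proof (rule nn_integral_eq_integral[OF f(1)])
  show "AE x in M. 0 \<le> f x * p x"
    using densitiesD(2)[OF p] by eventually_elim (simp add: f(2))
qed

lemma integrable_density_bound: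
  assumes p: "p \<in> densities M" and f: "f \<in> borel_measurable M"
    and g: "integrable M (\<lambda>x. g x * p x)" and le: "\<And>x. \<bar>f x\<bar> \<le> g x"
  shows "integrable M (\<lambda>x. f x * p x)"
proof (rule Bochner_Integration.integrable_bound[OF g])
  show "(\<lambda>x. f x * p x) \<in> borel_measurable M"
    using f densitiesD(1)[OF p] by measurable
  show "AE x in M. norm (f x * p x) \<le> norm (g x * p x)"
  proof (rule AE_I2)
    fix x
    have "\<bar>f x\<bar> \<le> \<bar>g x\<bar>" using le[of x] by linarith
    then show "norm (f x * p x) \<le> norm (g x * p x)"
      by (simp add: abs_mult mult_right_mono)
  qed
qed

section \<open>The Orlicz space of the reference density\<close>

text \<open>
  Subtracting \<open>1\<close> from \<open>cosh\<close> does not affect integrability because \<open>p\<close> has finite total mass.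
\<close>

lemma B_space_iff:
  assumes p: "p \<in> densities M"
  shows "u \<in> B_space M p \<longleftrightarrow> u \<in> borel_measurable M \<and>
    (\<exists>\<alpha>>0. integrable M (\<lambda>x. cosh (\<alpha> * u x) * p x)) \<and> expect M p u = 0"
proof -
  have "nn_expect M p (\<lambda>x. cosh (\<alpha> * u x) - 1) < \<infinity> \<longleftrightarrow> integrable M (\<lambda>x. cosh (\<alpha> * u x) * p x)"
    if [measurable]: "u \<in> borel_measurable M" for \<alpha>
  proof -
    have [measurable]: "(\<lambda>x. cosh (\<alpha> * u x)) \<in> borel_measurable M"
      unfolding cosh_def by measurable
    have "nn_expect M p (\<lambda>x. cosh (\<alpha> * u x) - 1) < \<infinity> \<longleftrightarrow>
        integrable M (\<lambda>x. (cosh (\<alpha> * u x) - 1) * p x)"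
      by (rule nn_expect_finite_iff[OF p]) (auto simp: cosh_real_ge_1)
    also have "\<dots> \<longleftrightarrow> integrable M (\<lambda>x. cosh (\<alpha> * u x) * p x)"
    proof
      assume "integrable M (\<lambda>x. (cosh (\<alpha> * u x) - 1) * p x)"
      from Bochner_Integration.integrable_add[OF this densitiesD(3)[OF p]]
      show "integrable M (\<lambda>x. cosh (\<alpha> * u x) * p x)"
        by (simp add: left_diff_distrib)
    next
      assume "integrable M (\<lambda>x. cosh (\<alpha> * u x) * p x)"
      from Bochner_Integration.integrable_diff[OF this densitiesD(3)[OF p]]
      show "integrable M (\<lambda>x. (cosh (\<alpha> * u x) - 1) * p x)"
        by (simp add: left_diff_distrib)
    qed
    finally show ?thesis .
  qed
  then show ?thesis by (auto simp: B_space_def)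
qed

lemma B_space_measurable: "u \<in> B_space M p \<Longrightarrow> u \<in> borel_measurable M"
  by (simp add: B_space_def)

lemma B_space_integrable:
  assumes p: "p \<in> densities M" and u: "u \<in> B_space M p"
  shows "integrable M (\<lambda>x. u x * p x)"
proof -
  from u obtain \<alpha> where \<alpha>: "\<alpha> > 0" "integrable M (\<lambda>x. cosh (\<alpha> * u x) * p x)"
    using B_space_iff[OF p] by blast
  have "integrable M (\<lambda>x. 2 / \<alpha> * (cosh (\<alpha> * u x) * p x))"
    using \<alpha>(2) by simp
  then have g: "integrable M (\<lambda>x. 2 / \<alpha> * cosh (\<alpha> * u x) * p x)"
    by (simp add: mult.assoc)
  show ?thesis
  proof (rule integrable_density_bound[OF p B_space_measurable[OF u] g])
    fix x
    show "\<bar>u x\<bar> \<le> 2 / \<alpha> * cosh (\<alpha> * u x)"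
      using abs_le_2_cosh[of "\<alpha> * u x"] \<alpha>(1) by (simp add: abs_mult field_simps)
  qed
qed

lemma B_space_zero:
  assumes p: "p \<in> densities M"
  shows "(\<lambda>x. 0) \<in> B_space M p"
proof -
  have "\<exists>\<alpha>>0::real. integrable M (\<lambda>x. cosh (\<alpha> * 0) * p x)"
    using densitiesD(3)[OF p] by (intro exI[of _ 1]) simp
  then show ?thesis
    unfolding B_space_iff[OF p] expect_def by simp
qed

text \<open>
  At half of the smaller exponent, \<open>|\<gamma> (u + v)|\<close> is at most the larger of \<open>|\<alpha> u|\<close> and \<open>|\<beta> v|\<close>,
  so its \<open>cosh\<close> is at most the sum of the two given ones.
\<close>

lemma B_space_add:
  assumes p: "p \<in> densities M" and u: "u \<in> B_space M p" and v: "v \<in> B_space M p"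
  shows "(\<lambda>x. u x + v x) \<in> B_space M p"
proof -
  note [measurable] = B_space_measurable[OF u] B_space_measurable[OF v]
  from u obtain \<alpha> where \<alpha>: "\<alpha> > 0" "integrable M (\<lambda>x. cosh (\<alpha> * u x) * p x)"
    using B_space_iff[OF p] by blast
  from v obtain \<beta> where \<beta>: "\<beta> > 0" "integrable M (\<lambda>x. cosh (\<beta> * v x) * p x)"
    using B_space_iff[OF p] by blast
  define \<gamma> where "\<gamma> = min \<alpha> \<beta> / 2"
  have \<gamma>: "\<gamma> > 0" "2 * \<gamma> \<le> \<alpha>" "2 * \<gamma> \<le> \<beta>" using \<alpha> \<beta> by (auto simp: \<gamma>_def)
  have g: "integrable M (\<lambda>x. (cosh (\<alpha> * u x) + cosh (\<beta> * v x)) * p x)"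
    using Bochner_Integration.integrable_add[OF \<alpha>(2) \<beta>(2)] by (simp add: distrib_right)
  have "integrable M (\<lambda>x. cosh (\<gamma> * (u x + v x)) * p x)"
  proof (rule integrable_density_bound[OF p _ g])
    show "(\<lambda>x. cosh (\<gamma> * (u x + v x))) \<in> borel_measurable M"
      unfolding cosh_def by measurable
  next
    fix x
    have 1: "2 * \<gamma> * \<bar>u x\<bar> \<le> \<alpha> * \<bar>u x\<bar>" "2 * \<gamma> * \<bar>v x\<bar> \<le> \<beta> * \<bar>v x\<bar>"
      using \<gamma> by (auto intro: mult_right_mono)
    have "\<gamma> * \<bar>u x + v x\<bar> \<le> \<gamma> * \<bar>u x\<bar> + \<gamma> * \<bar>v x\<bar>"
      using \<gamma>(1) by (simp flip: distrib_left)
    with 1 have "\<gamma> * \<bar>u x + v x\<bar> \<le> \<alpha> * \<bar>u x\<bar> \<or> \<gamma> * \<bar>u x + v x\<bar> \<le> \<beta> * \<bar>v x\<bar>"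
      by linarith
    then have "cosh (\<gamma> * (u x + v x)) \<le> cosh (\<alpha> * u x) \<or> cosh (\<gamma> * (u x + v x)) \<le> cosh (\<beta> * v x)"
      using \<alpha>(1) \<beta>(1) \<gamma>(1) by (auto simp: abs_mult intro!: cosh_mono_abs)
    then show "\<bar>cosh (\<gamma> * (u x + v x))\<bar> \<le> cosh (\<alpha> * u x) + cosh (\<beta> * v x)"
      using cosh_real_pos[of "\<alpha> * u x"] cosh_real_pos[of "\<beta> * v x"]
        cosh_real_pos[of "\<gamma> * (u x + v x)"] by linarith
  qed
  moreover have "expect M p (\<lambda>x. u x + v x) = 0"
  proof -
    have "expect M p (\<lambda>x. u x + v x) = expect M p u + expect M p v"
      using B_space_integrable[OF p u] B_space_integrable[OF p v]
      by (simp add: expect_def distrib_right)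
    also have "\<dots> = 0" using u v by (simp add: B_space_def)
    finally show ?thesis .
  qed
  moreover have "(\<lambda>x. u x + v x) \<in> borel_measurable M" by measurable
  ultimately show ?thesis
    unfolding B_space_iff[OF p] using \<gamma>(1) by blast
qed

lemma B_space_scale:
  assumes p: "p \<in> densities M" and u: "u \<in> B_space M p"
  shows "(\<lambda>x. c * u x) \<in> B_space M p"
proof -
  note [measurable] = B_space_measurable[OF u]
  from u obtain \<alpha> where \<alpha>: "\<alpha> > 0" "integrable M (\<lambda>x. cosh (\<alpha> * u x) * p x)"
    using B_space_iff[OF p] by blast
  define \<gamma> where "\<gamma> = \<alpha> / (1 + \<bar>c\<bar>)"
  have \<gamma>: "\<gamma> > 0" "\<gamma> * \<bar>c\<bar> \<le> \<alpha>" using \<alpha>(1) by (auto simp: \<gamma>_def field_simps)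
  have "integrable M (\<lambda>x. cosh (\<gamma> * (c * u x)) * p x)"
  proof (rule integrable_density_bound[OF p _ \<alpha>(2)])
    show "(\<lambda>x. cosh (\<gamma> * (c * u x))) \<in> borel_measurable M"
      unfolding cosh_def by measurable
  next
    fix x
    have "\<gamma> * \<bar>c\<bar> * \<bar>u x\<bar> \<le> \<alpha> * \<bar>u x\<bar>"
      using \<gamma>(2) by (rule mult_right_mono) simp
    then have "cosh (\<gamma> * (c * u x)) \<le> cosh (\<alpha> * u x)"
      using \<gamma>(1) \<alpha>(1) by (intro cosh_mono_abs) (simp add: abs_mult mult.assoc)
    then show "\<bar>cosh (\<gamma> * (c * u x))\<bar> \<le> cosh (\<alpha> * u x)"
      using cosh_real_pos[of "\<gamma> * (c * u x)"] by linarith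
  qed
  moreover have "expect M p (\<lambda>x. c * u x) = 0"
  proof -
    have "expect M p (\<lambda>x. c * u x) = c * expect M p u"
      by (simp add: expect_def mult.assoc)
    also have "\<dots> = 0" using u by (simp add: B_space_def)
    finally show ?thesis .
  qed
  moreover have "(\<lambda>x. c * u x) \<in> borel_measurable M" by measurable
  ultimately show ?thesis
    unfolding B_space_iff[OF p] using \<gamma>(1) by blast
qed

lemma lin_comb_B_space:
  assumes p: "p \<in> densities M" and u: "\<And>j. u j \<in> B_space M p"
  shows "lin_comb u c \<in> B_space M p"
proof -
  have "(\<lambda>x. \<Sum>j\<in>J. c $ j * u j x) \<in> B_space M p" if "finite J" for J
    using that by induction (simp_all add: B_space_zero B_space_add B_space_scale p u)
  from this[of UNIV] show ?thesis
    by (simp add: lin_comb_def[abs_def])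
qed

text \<open>
  This is what lets an interior point be moved a little along \<open>u\<close>. With \<open>C\<close> the
  expectation of \<open>cosh (\<alpha> u) - 1\<close>, convexity shows that
  \<open>cosh (\<alpha> u / (1 + C)) - 1\<close> has expectation at most \<open>C / (1 + C) \<le> 1\<close>. The radius
  \<open>\<epsilon> / 2\<close> is therefore admissible for \<open>s u\<close> as soon as \<open>|s| / (\<epsilon> / 2) \<le> \<alpha> / (1 + C)\<close>.
\<close>

lemma B_norm_small_multiples:
  assumes p: "p \<in> densities M" and u: "u \<in> B_space M p" and "\<epsilon> > 0"
  obtains t where "t > 0" "\<And>s. \<bar>s\<bar> \<le> t \<Longrightarrow> B_norm M p (\<lambda>x. s * u x) < \<epsilon>"
proof -
  note [measurable] = B_space_measurable[OF u]
  from u obtain \<alpha> where \<alpha>: "\<alpha> > 0" "integrable M (\<lambda>x. cosh (\<alpha> * u x) * p x)"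
    using B_space_iff[OF p] by blast
  have int: "integrable M (\<lambda>x. (cosh (\<alpha> * u x) - 1) * p x)"
    using Bochner_Integration.integrable_diff[OF \<alpha>(2) densitiesD(3)[OF p]]
    by (simp add: left_diff_distrib)
  define C where "C = expect M p (\<lambda>x. cosh (\<alpha> * u x) - 1)"
  have "C \<ge> 0"
    unfolding C_def expect_def
  proof (rule integral_nonneg_AE)
    show "AE x in M. 0 \<le> (cosh (\<alpha> * u x) - 1) * p x"
      using densitiesD(2)[OF p] by eventually_elim (simp add: cosh_real_ge_1)
  qed
  define \<sigma> where "\<sigma> = 1 / (1 + C)"
  have \<sigma>: "0 < \<sigma>" "\<sigma> \<le> 1" "\<sigma> * C \<le> 1"
    using \<open>C \<ge> 0\<close> by (auto simp: \<sigma>_def field_simps)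
  define t where "t = \<sigma> * \<alpha> * \<epsilon> / 2"
  show ?thesis
  proof
    show "t > 0" using \<sigma> \<alpha> \<open>\<epsilon> > 0\<close> by (simp add: t_def)
  next
    fix s assume s: "\<bar>s\<bar> \<le> t"
    have le: "cosh (s * u x / (\<epsilon> / 2)) - 1 \<le> \<sigma> * (cosh (\<alpha> * u x) - 1)" for x
    proof -
      have "\<bar>s * u x\<bar> \<le> t * \<bar>u x\<bar>"
        using s by (simp add: abs_mult mult_right_mono)
      then have "\<bar>s * u x / (\<epsilon> / 2)\<bar> \<le> t * \<bar>u x\<bar> / (\<epsilon> / 2)"
        using \<open>\<epsilon> > 0\<close> by (simp add: abs_mult field_simps)
      also have "\<dots> = \<bar>\<sigma> * (\<alpha> * u x)\<bar>"
        using \<open>\<epsilon> > 0\<close> \<sigma>(1) \<alpha>(1) by (simp add: t_def abs_mult)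
      finally have "cosh (s * u x / (\<epsilon> / 2)) \<le> cosh (\<sigma> * (\<alpha> * u x))"
        by (rule cosh_mono_abs)
      with cosh_minus_1_scale[of \<sigma> "\<alpha> * u x"] \<sigma> show ?thesis by linarith
    qed
    have "nn_expect M p (\<lambda>x. cosh (s * u x / (\<epsilon> / 2)) - 1)
        \<le> nn_expect M p (\<lambda>x. \<sigma> * (cosh (\<alpha> * u x) - 1))"
      unfolding nn_expect_def
    proof (rule nn_integral_mono_AE)
      show "AE x in M. ennreal ((cosh (s * u x / (\<epsilon> / 2)) - 1) * p x)
          \<le> ennreal (\<sigma> * (cosh (\<alpha> * u x) - 1) * p x)"
        using densitiesD(2)[OF p]
        by eventually_elim (intro ennreal_leI mult_right_mono le less_imp_le)
    qed
    also have "\<dots> = ennreal (expect M p (\<lambda>x. \<sigma> * (cosh (\<alpha> * u x) - 1)))"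
      using int \<sigma>(1) by (intro nn_expect_eq_expect[OF p]) (simp_all add: mult.assoc cosh_real_ge_1)
    also have "expect M p (\<lambda>x. \<sigma> * (cosh (\<alpha> * u x) - 1)) = \<sigma> * C"
      by (simp add: expect_def C_def mult.assoc)
    also have "ennreal (\<sigma> * C) \<le> 1"
      using \<sigma>(3) by simp
    finally have "B_norm M p (\<lambda>x. s * u x) \<le> \<epsilon> / 2"
      unfolding B_norm_def using \<open>\<epsilon> > 0\<close> by (intro cInf_lower bdd_belowI[of _ 0]) auto
    with \<open>\<epsilon> > 0\<close> show "B_norm M p (\<lambda>x. s * u x) < \<epsilon>" by simp
  qed
qed

section \<open>Exponential moments inside the domain of the cumulant functional\<close>

lemma cumulant_dom_exp_integrable:
  assumes p: "p \<in> densities M" and w: "w \<in> cumulant_dom M p"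
  shows "integrable M (\<lambda>x. exp (w x) * p x)"
proof -
  have [measurable]: "w \<in> borel_measurable M"
    using w by (auto simp: cumulant_dom_def B_space_measurable)
  have "nn_expect M p (\<lambda>x. exp (w x)) < \<infinity>"
    using w by (auto simp: cumulant_dom_def cumulant_def Let_def less_top split: if_splits)
  then show ?thesis
    by (subst (asm) nn_expect_finite_iff[OF p]) auto
qed

text \<open>
  A point belongs to every ball around it only because \<open>B_norm\<close> vanishes at the zero function, an
  infimum over all positive radii; this is read off from the multiple \<open>0\<close> of \<open>w\<close>.
\<close>

lemma B_interior_subset:
  assumes p: "p \<in> densities M" and w: "w \<in> B_interior M p D"
  shows "w \<in> D"
proof -
  from w obtain \<epsilon> where wB: "w \<in> B_space M p" and "\<epsilon> > 0"
    and \<epsilon>: "\<And>v. v \<in> B_space M p \<Longrightarrow> B_norm M p (\<lambda>x. v x - w x) < \<epsilon> \<Longrightarrow> v \<in> D"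
    by (auto simp: B_interior_def)
  obtain t where "t > 0" and t: "\<And>s. \<bar>s\<bar> \<le> t \<Longrightarrow> B_norm M p (\<lambda>x. s * w x) < \<epsilon>"
    using B_norm_small_multiples[OF p wB \<open>\<epsilon> > 0\<close>] by blast
  have "B_norm M p (\<lambda>x. w x - w x) < \<epsilon>"
    using t[of 0] \<open>t > 0\<close> by simp
  then show ?thesis by (rule \<epsilon>[OF wB])
qed

text \<open>
  An interior point can be moved in both directions along \<open>u\<close> without
  leaving the domain, and the sum of the two exponentials dominates \<open>u\<^sup>2 exp w\<close>.
\<close>

lemma interior_square_exp_integrable:
  assumes p: "p \<in> densities M" and w: "w \<in> B_interior M p (cumulant_dom M p)"
    and u: "u \<in> B_space M p"
  shows "integrable M (\<lambda>x. (u x)\<^sup>2 * exp (w x) * p x)"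
proof -
  from w obtain \<epsilon> where wB: "w \<in> B_space M p" and "\<epsilon> > 0"
    and \<epsilon>: "\<And>v. v \<in> B_space M p \<Longrightarrow> B_norm M p (\<lambda>x. v x - w x) < \<epsilon> \<Longrightarrow> v \<in> cumulant_dom M p"
    by (auto simp: B_interior_def)
  note [measurable] = B_space_measurable[OF u] B_space_measurable[OF wB]
  obtain t where t: "t > 0" "\<And>s. \<bar>s\<bar> \<le> t \<Longrightarrow> B_norm M p (\<lambda>x. s * u x) < \<epsilon>"
    using B_norm_small_multiples[OF p u \<open>\<epsilon> > 0\<close>] by blast
  have exp_int: "integrable M (\<lambda>x. exp (w x + s * u x) * p x)" if "\<bar>s\<bar> \<le> t" for s
    using t(2)[OF that]
    by (intro cumulant_dom_exp_integrable[OF p] \<epsilon> B_space_add[OF p wB] B_space_scale[OF p u]) simp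
  have "integrable M (\<lambda>x. 2 / t\<^sup>2 * (exp (w x + t * u x) * p x + exp (w x + (- t) * u x) * p x))"
    using t(1) by (intro integrable_mult_right Bochner_Integration.integrable_add exp_int) simp_all
  then have g: "integrable M (\<lambda>x. 2 / t\<^sup>2 * (exp (w x + t * u x) + exp (w x + (- t) * u x)) * p x)"
    by (simp only: distrib_right mult.assoc)
  show ?thesis
  proof (rule integrable_density_bound[OF p _ g])
    fix x
    have "exp (w x) * (t * u x)\<^sup>2 \<le> exp (w x) * (4 * cosh (t * u x))"
      by (intro mult_left_mono square_le_4_cosh) simp
    also have "\<dots> = 2 * (exp (w x + t * u x) + exp (w x + (- t) * u x))"
      unfolding exp_add cosh_def by (simp add: algebra_simps)
    finally show "\<bar>(u x)\<^sup>2 * exp (w x)\<bar> \<le> 2 / t\<^sup>2 * (exp (w x + t * u x) + exp (w x + (- t) * u x))"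
      using t(1) by (simp add: abs_mult power_mult_distrib field_simps)
  next
    show "(\<lambda>x. (u x)\<^sup>2 * exp (w x)) \<in> borel_measurable M" by measurable
  qed
qed

text \<open>
  On \<open>\<Theta>\<close> the extended-real cumulant is the logarithm of a positive real number, so
  \<open>exp (w - \<psi>)\<close> is \<open>exp w\<close> divided by its normalizing constant. The constant is positive
  because otherwise \<open>p\<close> would vanish almost everywhere, against its total mass \<open>1\<close>.
\<close>

lemma exp_density_eq:
  assumes p: "p \<in> densities M" and u: "\<And>j. u j \<in> B_space M p" and \<theta>: "\<theta> \<in> Theta M p u"
  defines "Z \<equiv> expect M p (\<lambda>x. exp (lin_comb u \<theta> x))"
  shows "Z > 0" "integrable M (\<lambda>x. exp (lin_comb u \<theta> x) * p x)"
    "exp_density M p u \<theta> = (\<lambda>x. exp (lin_comb u \<theta> x) * p x / Z)"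
proof -
  have "lin_comb u \<theta> \<in> cumulant_dom M p"
    by (rule B_interior_subset[OF p]) (use \<theta> in \<open>simp add: Theta_def\<close>)
  then show int: "integrable M (\<lambda>x. exp (lin_comb u \<theta> x) * p x)"
    by (rule cumulant_dom_exp_integrable[OF p])
  have pos: "AE x in M. 0 < exp (lin_comb u \<theta> x) * p x"
    using densitiesD(2)[OF p] by eventually_elim simp
  show "Z > 0"
  proof (rule ccontr)
    assume "\<not> Z > 0"
    moreover have nonneg: "AE x in M. 0 \<le> exp (lin_comb u \<theta> x) * p x"
      using pos by eventually_elim simp
    ultimately have "(\<integral>x. exp (lin_comb u \<theta> x) * p x \<partial>M) = 0"
      using integral_nonneg_AE[OF nonneg] by (simp add: Z_def expect_def)
    then have "AE x in M. exp (lin_comb u \<theta> x) * p x = 0"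
      using integral_nonneg_eq_0_iff_AE[OF int nonneg] by simp
    with pos have "AE x in M. p x = 0"
      by eventually_elim simp
    then have "(\<integral>x. p x \<partial>M) = 0"
      using integral_eq_zero_AE by blast
    with densitiesD(4)[OF p] show False by simp
  qed
  have "psi M p u \<theta> = ln Z"
    using \<open>Z > 0\<close> nn_expect_eq_expect[OF p int]
    by (simp add: psi_def cumulant_def Z_def Let_def)
  with \<open>Z > 0\<close> show "exp_density M p u \<theta> = (\<lambda>x. exp (lin_comb u \<theta> x) * p x / Z)"
    by (simp add: exp_density_def exp_diff fun_eq_iff)
qed

lemma exp_density_in_densities:
  assumes p: "p \<in> densities M" and u: "\<And>j. u j \<in> B_space M p" and \<theta>: "\<theta> \<in> Theta M p u"
  shows "exp_density M p u \<theta> \<in> densities M"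
proof -
  define Z where "Z = expect M p (\<lambda>x. exp (lin_comb u \<theta> x))"
  note eq = exp_density_eq[where M = M and u = u, OF p u \<theta>, folded Z_def]
  have "AE x in M. 0 < exp (lin_comb u \<theta> x) * p x / Z"
    using densitiesD(2)[OF p] by eventually_elim (use eq(1) in simp)
  moreover have "(\<integral>x. exp (lin_comb u \<theta> x) * p x / Z \<partial>M) = 1"
    using eq(1) by (simp add: Z_def expect_def)
  moreover have "integrable M (\<lambda>x. exp (lin_comb u \<theta> x) * p x / Z)"
    using eq(2) by simp
  moreover from this have "(\<lambda>x. exp (lin_comb u \<theta> x) * p x / Z) \<in> borel_measurable M"
    by (rule borel_measurable_integrable)
  ultimately show ?thesis
    unfolding eq(3) densities_def mem_Collect_eq by (intro conjI)
qed

lemma square_integrable_exp_density: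
  assumes p: "p \<in> densities M" and u: "\<And>j. u j \<in> B_space M p" and \<theta>: "\<theta> \<in> Theta M p u"
  shows "integrable M (\<lambda>x. (u j x)\<^sup>2 * exp_density M p u \<theta> x)"
proof -
  have "integrable M (\<lambda>x. (u j x)\<^sup>2 * exp (lin_comb u \<theta> x) * p x)"
    using \<theta> by (intro interior_square_exp_integrable[OF p _ u]) (simp add: Theta_def)
  then show ?thesis
    by (simp add: exp_density_eq(3)[where M = M and u = u, OF p u \<theta>] mult.assoc)
qed

section \<open>The matrix of second moments\<close>

lemma V_simps [simp]: "V u x $ Inl j = u j x" "V u x $ Inr a = 1"
  by (simp_all add: V_def)

lemma V_measurable [measurable]:
  assumes "\<And>j. u j \<in> borel_measurable M"
  shows "(\<lambda>x. V u x $ i) \<in> borel_measurable M"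
  using assms by (cases i) simp_all

lemma V_products_integrable:
  assumes q: "q \<in> densities M" and u: "\<And>j. u j \<in> borel_measurable M"
    and sq: "\<And>j. integrable M (\<lambda>x. (u j x)\<^sup>2 * q x)"
  shows "integrable M (\<lambda>x. V u x $ i * V u x $ k * q x)"
proof -
  note [measurable] = V_measurable[of u, OF u]
  have V2: "integrable M (\<lambda>x. (V u x $ i)\<^sup>2 * q x)" for i
    by (cases i) (simp_all add: sq densitiesD(3)[OF q])
  have g: "integrable M (\<lambda>x. ((V u x $ i)\<^sup>2 + (V u x $ k)\<^sup>2) * q x)"
    using Bochner_Integration.integrable_add[OF V2[of i] V2[of k]] by (simp add: distrib_right)
  show ?thesis
  proof (rule integrable_density_bound[OF q _ g])
    fix x
    show "\<bar>V u x $ i * V u x $ k\<bar> \<le> (V u x $ i)\<^sup>2 + (V u x $ k)\<^sup>2"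
      using sum_squares_bound[of "\<bar>V u x $ i\<bar>" "\<bar>V u x $ k\<bar>"]
        mult_nonneg_nonneg[of "\<bar>V u x $ i\<bar>" "\<bar>V u x $ k\<bar>"]
      unfolding abs_mult power2_abs by linarith
  qed measurable
qed

text \<open>
  The matrix of second moments is the Gram matrix of the entries of \<open>V\<close>. For a density \<open>q\<close> the
  form is therefore nonnegative, and it vanishes at \<open>z\<close> only if \<open>z\<^sup>T V = 0\<close> almost everywhere.
\<close>

lemma F_map_quadratic_form:
  assumes "\<And>i k. integrable M (\<lambda>x. V u x $ i * V u x $ k * q x)"
  shows "z \<bullet> (F_map M u q *v z) = expect M q (\<lambda>x. (z \<bullet> V u x)\<^sup>2)"
    and "integrable M (\<lambda>x. (z \<bullet> V u x)\<^sup>2 * q x)"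
proof -
  have eq: "(z \<bullet> V u x)\<^sup>2 * q x =
      (\<Sum>i\<in>UNIV. \<Sum>k\<in>UNIV. z $ i * z $ k * (V u x $ i * V u x $ k * q x))" for x
    by (simp add: inner_vec_def power2_eq_square sum_product sum_distrib_left sum_distrib_right
        algebra_simps)
  show "integrable M (\<lambda>x. (z \<bullet> V u x)\<^sup>2 * q x)"
    unfolding eq by (intro Bochner_Integration.integrable_sum integrable_mult_right assms)
  have "expect M q (\<lambda>x. (z \<bullet> V u x)\<^sup>2) =
      (\<Sum>i\<in>UNIV. \<Sum>k\<in>UNIV. z $ i * z $ k * (\<integral>x. V u x $ i * V u x $ k * q x \<partial>M))"
    unfolding expect_def eq using assms
    by (simp add: Bochner_Integration.integral_sum)
  then show "z \<bullet> (F_map M u q *v z) = expect M q (\<lambda>x. (z \<bullet> V u x)\<^sup>2)"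
    by (simp add: inner_vec_def matrix_vector_mult_def F_map_def expect_def sum_distrib_left
        algebra_simps)
qed

lemma inner_V: "z \<bullet> V u x = lin_comb u (\<chi> j. z $ Inl j) x + z $ Inr ()"
proof -
  have "(\<Sum>i\<in>UNIV. z $ i * V u x $ i) = (\<Sum>i\<in>UNIV <+> UNIV. z $ i * V u x $ i)"
    by simp
  also have "\<dots> = (\<Sum>j\<in>UNIV. z $ Inl j * u j x) + (\<Sum>a\<in>UNIV. z $ Inr a)"
    by (subst sum.Plus) simp_all
  finally show ?thesis
    by (simp add: inner_vec_def lin_comb_def UNIV_unit)
qed

text \<open>
  Constants are orthogonal to the centred functions in \<open>L\<^sup>2(p\<cdot>\<mu>)\<close>, so adjoining the constant \<open>1\<close>
  to an independent family in \<open>B\<^sub>p\<close> keeps it independent.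
\<close>

lemma lin_indep_with_constant:
  assumes p: "p \<in> densities M" and u: "\<And>j. u j \<in> B_space M p" and li: "lin_indep_L2 M p u"
    and zero: "AE x in M. lin_comb u c x + b = 0"
  shows "c = 0 \<and> b = 0"
proof -
  have c: "lin_comb u c \<in> B_space M p" by (rule lin_comb_B_space[OF p u])
  have "(\<integral>x. lin_comb u c x * p x + b * p x \<partial>M) = 0"
    using zero by (intro integral_eq_zero_AE, eventually_elim) (simp flip: distrib_right)
  moreover have "(\<integral>x. lin_comb u c x * p x + b * p x \<partial>M) = expect M p (lin_comb u c) + b"
    using B_space_integrable[OF p c] densitiesD(3,4)[OF p] by (simp add: expect_def)
  ultimately have "b = 0" using c by (simp add: B_space_def)
  with zero have "AE x in M. lin_comb u c x = 0" by simp
  then have "AE x in density M (\<lambda>x. ennreal (p x)). lin_comb u c x = 0"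
    using densitiesD(1)[OF p] by (subst AE_density) auto
  with li \<open>b = 0\<close> show ?thesis by (auto simp: lin_indep_L2_def)
qed

text \<open>
  The independence hypothesis concerns \<open>p\<close> while the moments are taken under another density
  \<open>q\<close>. The two are linked through null sets: both are positive almost everywhere.
\<close>

lemma F_map_SPD:
  assumes p: "p \<in> densities M" and u: "\<And>j. u j \<in> B_space M p" and li: "lin_indep_L2 M p u"
    and q: "q \<in> densities M"
    and int: "\<And>i k. integrable M (\<lambda>x. V u x $ i * V u x $ k * q x)"
  shows "F_map M u q \<in> SPD"
proof -
  have "transpose (F_map M u q) = F_map M u q"
    by (simp add: transpose_def F_map_def mult.commute)
  moreover have "z \<bullet> (F_map M u q *v z) > 0" if "z \<noteq> 0" for z
  proof (rule ccontr)
    assume neg: "\<not> z \<bullet> (F_map M u q *v z) > 0"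
    have nonneg: "AE x in M. 0 \<le> (z \<bullet> V u x)\<^sup>2 * q x"
      using densitiesD(2)[OF q] by eventually_elim simp
    have "(\<integral>x. (z \<bullet> V u x)\<^sup>2 * q x \<partial>M) = 0"
      using neg integral_nonneg_AE[OF nonneg]
      by (simp add: F_map_quadratic_form(1)[OF int] expect_def)
    then have "AE x in M. (z \<bullet> V u x)\<^sup>2 * q x = 0"
      using integral_nonneg_eq_0_iff_AE[OF F_map_quadratic_form(2)[OF int] nonneg] by simp
    with densitiesD(2)[OF q]
    have "AE x in M. lin_comb u (\<chi> j. z $ Inl j) x + z $ Inr () = 0"
      by eventually_elim (simp add: inner_V)
    then have "(\<chi> j. z $ Inl j) = (0 :: real ^ 'b) \<and> z $ Inr () = 0"
      by (rule lin_indep_with_constant[OF p u li])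
    then have "z $ i = 0" for i
      by (cases i) (auto simp: vec_eq_iff)
    with \<open>z \<noteq> 0\<close> show False by (simp add: vec_eq_iff)
  qed
  ultimately show ?thesis by (simp add: SPD_def)
qed

lemma F_map_cong_AE:
  assumes q: "q \<in> borel_measurable M" "q' \<in> borel_measurable M" "AE x in M. q' x = q x"
    and u: "\<And>j. u j \<in> borel_measurable M" "\<And>j. v j \<in> borel_measurable M"
      "\<And>j. AE x in M. v j x = u j x"
  shows "integrable M (\<lambda>x. V v x $ i * V v x $ k * q' x) \<longleftrightarrow>
      integrable M (\<lambda>x. V u x $ i * V u x $ k * q x)"
    and "F_map M v q' = F_map M u q"
proof -
  note [measurable] = q V_measurable[of u, OF u(1)] V_measurable[of v, OF u(2)]
  have V_eq: "AE x in M. V v x $ i = V u x $ i" for i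
    using u(3) by (cases i) simp_all
  have ae: "AE x in M. V v x $ i * V v x $ k * q' x = V u x $ i * V u x $ k * q x" for i k
    using V_eq[of i] V_eq[of k] q(3) by eventually_elim simp
  show "integrable M (\<lambda>x. V v x $ i * V v x $ k * q' x) \<longleftrightarrow>
      integrable M (\<lambda>x. V u x $ i * V u x $ k * q x)"
    by (intro integrable_cong_AE ae) measurable
  have "expect M q' (\<lambda>x. V v x $ i * V v x $ k) = expect M q (\<lambda>x. V u x $ i * V u x $ k)" for i k
    unfolding expect_def by (intro integral_cong_AE ae) measurable
  then show "F_map M v q' = F_map M u q" by (simp add: F_map_def)
qed

lemma F_map_block:
  assumes "q \<in> densities M"
  shows "F_map M u q = block_mat (\<chi> j k. expect M q (\<lambda>x. u j x * u k x))
    (\<chi> j. expect M q (u j)) (\<chi> j. expect M q (u j)) 1"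
  using densitiesD(4)[OF assms]
  by (auto simp: F_map_def block_mat_def vec_eq_iff expect_def split: sum.splits)

theorem theorem5p1:
  fixes M :: "'x measure" and p :: "'x \<Rightarrow> real" and u :: "'d::finite \<Rightarrow> 'x \<Rightarrow> real"
  assumes "sigma_finite_measure M"
    and "p \<in> densities M"
    and "\<And>j. u j \<in> B_space M p"
    and "lin_indep_L2 M p u"
  shows "(\<forall>\<theta> \<in> Theta M p u. F_well_defined_at M p u \<theta>) \<and>
    F_map M u \<in> exp_family M p u \<rightarrow> SPD \<and>
    (\<forall>\<theta> \<in> Theta M p u. S M p u \<theta> \<in> SPD) \<and>
    (\<forall>\<theta> \<in> Theta M p u.
       S M p u \<theta> = block_mat (A_block M p u \<theta>) (eta M p u \<theta>) (eta M p u \<theta>) 1)"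
proof -
  note p = assms(2) and u = assms(3)
  have um: "u j \<in> borel_measurable M" for j
    by (rule B_space_measurable[OF u])
  have dens: "exp_density M p u \<theta> \<in> densities M" if "\<theta> \<in> Theta M p u" for \<theta>
    using that by (intro exp_density_in_densities p u)
  have int: "integrable M (\<lambda>x. V u x $ i * V u x $ k * exp_density M p u \<theta> x)"
    if "\<theta> \<in> Theta M p u" for \<theta> i k
    using that by (intro V_products_integrable dens um square_integrable_exp_density p u)
  have spd: "S M p u \<theta> \<in> SPD" if "\<theta> \<in> Theta M p u" for \<theta>
    unfolding S_def using that by (intro F_map_SPD[OF p u assms(4)] dens int)
  have "F_well_defined_at M p u \<theta>" if \<theta>: "\<theta> \<in> Theta M p u" for \<theta>
    unfolding F_well_defined_at_def S_def
  proof (intro conjI allI impI dens[OF \<theta>])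
    fix q :: "'x \<Rightarrow> real" and v :: "'d \<Rightarrow> 'x \<Rightarrow> real" and i k
    assume "q \<in> borel_measurable M" "AE x in M. q x = exp_density M p u \<theta> x"
      and "\<forall>j. v j \<in> borel_measurable M \<and> (AE x in M. v j x = u j x)"
    then have v: "\<And>j. v j \<in> borel_measurable M" "\<And>j. AE x in M. v j x = u j x"
      and q: "q \<in> borel_measurable M" "AE x in M. q x = exp_density M p u \<theta> x"
      by auto
    note cong = F_map_cong_AE[where u = u and v = v,
        OF densitiesD(1)[OF dens[OF \<theta>]] q um v]
    show "integrable M (\<lambda>x. V v x $ i * V v x $ k * q x)"
      using cong(1) int[OF \<theta>] by blast
    show "F_map M v q = F_map M u (exp_density M p u \<theta>)"
      by (rule cong(2))
  qed
  moreover have "F_map M u \<in> exp_family M p u \<rightarrow> SPD"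
    using spd by (auto simp: exp_family_def S_def)
  moreover have "S M p u \<theta> = block_mat (A_block M p u \<theta>) (eta M p u \<theta>) (eta M p u \<theta>) 1"
    if "\<theta> \<in> Theta M p u" for \<theta>
    unfolding S_def A_block_def eta_def by (rule F_map_block[OF dens[OF that]])
  ultimately show ?thesis using spd by blast
qed

end
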